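(* Suppose the parameter vector $\boldsymbol{a}=(a_s)_{s\in\mathcal{S}}$ depends on a single parameter $\alpha>0$ as follows: $a_s=\alpha^{\gamma_s}$, $s\in\mathcal{S}$. Then, as $\alpha\downarrow0$, $$\boldsymbol{x}^{*,\boldsymbol{a}}\to\mathcal{X}^*\qquad\text{and}\qquad(-\log\alpha)^{-1}\boldsymbol{\nu}^{*,\boldsymbol{a}}\to\mathcal{H}^*,$$ where convergence of a point to a set $U$ means that its Euclidean distance to $U$ tends to $0$.
   Context: **Configurations.** There are customer types $i\in\mathcal{I}=\{1,\dots,I\}$ and server types $s\in\mathcal{S}=\{1,\dots,S\}$. For each $s$ there is a finite set $\bar{\mathcal{K}}^s$ of configurations $\boldsymbol{k}=(k_1,\dots,k_I;s)$ with non-negative integers $k_i$. Monotonicity: if $\boldsymbol{k}\in\bar{\mathcal{K}}^s$ and $0\le k_i'\le k_i$ for all $i$ (integers), then $(k_1',\dots,k_I';s)\in\bar{\mathcal{K}}^s$. The zero configuration $\boldsymbol{0}^s=(0,\dots,0;s)$ belongs to $\bar{\mathcal{K}}^s$ for each $s$. For each $i$ there is at least one $s$ with $(\boldsymbol{e}_i;s)\in\bar{\mathcal{K}}^s$, where $\boldsymbol{e}_i$ is the $i$-th unit vector. Put $\mathcal{K}^s=\bar{\mathcal{K}}^s\setminus\{\boldsymbol{0}^s\}$ and $\mathcal{K}=\bigcup_s\mathcal{K}^s$. **Parameters.** $\rho_i>0$, $i\in\mathcal{I}$, are fixed with $\sum_i\rho_i=1$. The server weights $\gamma_s>0$, $s\in\mathcal{S}$,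 are fixed, scaled so that $\gamma_1=1$. Let $$\mathcal{X}=\Big\{\boldsymbol{x}\in\mathbb{R}_+^{|\mathcal{K}|}:\ \sum_{\boldsymbol{k}\in\mathcal{K}}k_ix_{\boldsymbol{k}}=\rho_i\ \ \forall i\in\mathcal{I}\Big\}.$$ **Linear program.** $\mathcal{X}^*\subseteq\mathcal{X}$ is the set of optimal solutions of $\min_{\boldsymbol{x}\in\mathcal{X}}\sum_{s\in\mathcal{S}}\sum_{\boldsymbol{k}\in\mathcal{K}^s}\gamma_sx_{\boldsymbol{k}}$. $\mathcal{H}^*$ is the set of vectors $\boldsymbol{\eta}=(\eta_i)_{i\in\mathcal{I}}$ for which there is some $\boldsymbol{x}\in\mathcal{X}$ such that: $\eta_i\ge0$ for all $i$; $\sum_ik_i\eta_i\le\gamma_s$ for all $s$ and $\boldsymbol{k}\in\mathcal{K}^s$; and for all $s$ and $\boldsymbol{k}\in\mathcal{K}^s$, $\sum_ik_i\eta_i<\gamma_s$ implies $x_{\boldsymbol{k}}=0$. (Equivalently, $\mathcal{H}^*$ is the set of optimal solutions of the dual of the LP of minimizing the same objective over $\boldsymbol{x}\in\mathbb{R}_+^{|\mathcal{K}|}$ subject to $\sum_{\boldsymbol{k}}k_ix_{\boldsymbol{k}}\ge\rho_i$ for all $i$.) **Point $\boldsymbol{x}^{*,\boldsymbol{a}}$ and multipliers $\boldsymbol{\nu}^{*,\boldsymbol{a}}$.** For a vector $\boldsymbol{a}=(a_s)_{s\in\mathcal{S}}$ with $a_s>0$, and with $c_{\boldsymbol{k}}=\prod_ik_i!$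 and $0\log0=0$, let $$L^{(\boldsymbol{a})}(\boldsymbol{x})=\sum_{s\in\mathcal{S}}\sum_{\boldsymbol{k}\in\mathcal{K}^s}x_{\boldsymbol{k}}\log\frac{x_{\boldsymbol{k}}c_{\boldsymbol{k}}}{e\,a_s},$$ which is strictly convex on $\mathbb{R}_+^{|\mathcal{K}|}$. $\boldsymbol{x}^{*,\boldsymbol{a}}$ is its unique minimizer over $\mathcal{X}$, and $\boldsymbol{\nu}^{*,\boldsymbol{a}}=(\nu_i^{*,\boldsymbol{a}})_{i\in\mathcal{I}}\in\mathbb{R}^I$ is the (unique) vector of Lagrange multipliers of the equality constraints $\sum_{\boldsymbol{k}}k_ix_{\boldsymbol{k}}=\rho_i$, i.e. the unique vector such that $$x^{*,\boldsymbol{a}}_{\boldsymbol{k}}=\frac{a_s}{c_{\boldsymbol{k}}}\exp\Big[\sum_ik_i\nu_i^{*,\boldsymbol{a}}\Big]\quad\text{for all }s\in\mathcal{S},\ \boldsymbol{k}\in\mathcal{K}^s.$$ *)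

theory Defs
  imports "HOL-Analysis.Analysis"
begin

text \<open>
  Customer types are the elements of a finite type \<open>'i\<close>, server types those of a finite type \<open>'s\<close>.
  \<open>Kbar s\<close> is the set of count vectors \<open>k\<close> such that \<open>(k; s)\<close> is a configuration of server type \<open>s\<close>.
  The tagged configuration \<open>(k; s)\<close> is the pair \<open>(k, s)\<close>, so equal counts at different server types
  give different coordinates.
\<close>

definition nz_configs :: "('s \<Rightarrow> ('i \<Rightarrow> nat) set) \<Rightarrow> 's \<Rightarrow> ('i \<Rightarrow> nat) set" where
  "nz_configs Kbar s = Kbar s - {\<lambda>_. 0}"

definition all_configs :: "('s \<Rightarrow> ('i \<Rightarrow> nat) set) \<Rightarrow> (('i \<Rightarrow> nat) \<times> 's) set" where
  "all_configs Kbar = {(k, s). k \<in> nz_configs Kbar s}"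

text \<open>
  A vector with coordinates indexed by \<open>all_configs Kbar\<close> is an extensional function on that set,
  so that it is determined by those coordinates.
\<close>

definition feasible ::
  "('s \<Rightarrow> ('i \<Rightarrow> nat) set) \<Rightarrow> ('i \<Rightarrow> real) \<Rightarrow> (('i \<Rightarrow> nat) \<times> 's \<Rightarrow> real) set" where
  "feasible Kbar \<rho> =
    {x \<in> all_configs Kbar \<rightarrow>\<^sub>E {0..}. \<forall>i. (\<Sum>(k, s)\<in>all_configs Kbar. real (k i) * x (k, s)) = \<rho> i}"

definition weighted_servers ::
  "('s::finite \<Rightarrow> ('i \<Rightarrow> nat) set) \<Rightarrow> ('s \<Rightarrow> real) \<Rightarrow> (('i \<Rightarrow> nat) \<times> 's \<Rightarrow> real) \<Rightarrow> real" where
  "weighted_servers Kbar \<gamma> x = (\<Sum>s\<in>UNIV. \<Sum>k\<in>nz_configs Kbar s. \<gamma> s * x (k, s))"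

definition lp_optima ::
  "('s::finite \<Rightarrow> ('i \<Rightarrow> nat) set) \<Rightarrow> ('i \<Rightarrow> real) \<Rightarrow> ('s \<Rightarrow> real) \<Rightarrow>
    (('i \<Rightarrow> nat) \<times> 's \<Rightarrow> real) set" where
  "lp_optima Kbar \<rho> \<gamma> =
    {x. is_arg_min (weighted_servers Kbar \<gamma>) (\<lambda>y. y \<in> feasible Kbar \<rho>) x}"

definition dual_optima ::
  "('s \<Rightarrow> ('i::finite \<Rightarrow> nat) set) \<Rightarrow> ('i \<Rightarrow> real) \<Rightarrow> ('s \<Rightarrow> real) \<Rightarrow> ('i \<Rightarrow> real) set" where
  "dual_optima Kbar \<rho> \<gamma> =
    {\<eta>. \<exists>x\<in>feasible Kbar \<rho>.
       (\<forall>i. 0 \<le> \<eta> i) \<and>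
       (\<forall>s. \<forall>k\<in>nz_configs Kbar s. (\<Sum>i\<in>UNIV. real (k i) * \<eta> i) \<le> \<gamma> s) \<and>
       (\<forall>s. \<forall>k\<in>nz_configs Kbar s. (\<Sum>i\<in>UNIV. real (k i) * \<eta> i) < \<gamma> s \<longrightarrow> x (k, s) = 0)}"

definition config_fact :: "('i::finite \<Rightarrow> nat) \<Rightarrow> real" where
  "config_fact k = (\<Prod>i\<in>UNIV. fact (k i))"

text \<open>The convention \<open>0 log 0 = 0\<close> holds because the logarithm is multiplied by \<open>x (k, s)\<close>.\<close>

definition entropy_obj ::
  "('s::finite \<Rightarrow> ('i::finite \<Rightarrow> nat) set) \<Rightarrow> ('s \<Rightarrow> real) \<Rightarrow>
    (('i \<Rightarrow> nat) \<times> 's \<Rightarrow> real) \<Rightarrow> real" where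
  "entropy_obj Kbar a x =
    (\<Sum>s\<in>UNIV. \<Sum>k\<in>nz_configs Kbar s. x (k, s) * ln (x (k, s) * config_fact k / (exp 1 * a s)))"

definition x_star ::
  "('s::finite \<Rightarrow> ('i::finite \<Rightarrow> nat) set) \<Rightarrow> ('i \<Rightarrow> real) \<Rightarrow> ('s \<Rightarrow> real) \<Rightarrow>
    (('i \<Rightarrow> nat) \<times> 's \<Rightarrow> real)" where
  "x_star Kbar \<rho> a = (THE x. is_arg_min (entropy_obj Kbar a) (\<lambda>y. y \<in> feasible Kbar \<rho>) x)"

definition nu_star ::
  "('s::finite \<Rightarrow> ('i::finite \<Rightarrow> nat) set) \<Rightarrow> ('i \<Rightarrow> real) \<Rightarrow> ('s \<Rightarrow> real) \<Rightarrow> ('i \<Rightarrow> real)" where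
  "nu_star Kbar \<rho> a =
    (THE \<nu>. \<forall>s. \<forall>k\<in>nz_configs Kbar s.
       x_star Kbar \<rho> a (k, s) = a s / config_fact k * exp (\<Sum>i\<in>UNIV. real (k i) * \<nu> i))"

text \<open>
  Euclidean distance from \<open>x\<close> to the set \<open>U\<close> in the space of vectors with coordinates in \<open>J\<close>.
  It is extended-real valued, so the distance to the empty set is \<open>\<infinity>\<close>, and convergence of the
  distance to 0 forces \<open>U\<close> to be nonempty (unlike with \<^const>\<open>infdist\<close>).
\<close>

definition euclid_dist_set :: "'j set \<Rightarrow> ('j \<Rightarrow> real) \<Rightarrow> ('j \<Rightarrow> real) set \<Rightarrow> ereal" where
  "euclid_dist_set J x U = (INF y\<in>U. ereal (L2_set (\<lambda>j. x j - y j) J))"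

end

theory Submission imports Defs begin

text \<open>
  The entropy minimizer has the exponential form \<open>x (k, s) = a s / config_fact k * exp (k \<cdot> \<nu>)\<close>.
  With \<open>a s = \<alpha> powr \<gamma> s\<close>, \<open>t = - ln \<alpha>\<close> and \<open>\<eta> = \<nu> / t\<close> it reads
  \<open>x (k, s) = exp (t * (k \<cdot> \<eta> - \<gamma> s)) / config_fact k\<close>. As \<open>\<alpha>\<close> decreases to 0, \<open>t\<close> tends to infinity.
  The coordinates of \<open>x\<close> stay bounded because of the moment constraints, so in the limit no
  configuration can have \<open>k \<cdot> \<eta> > \<gamma> s\<close>, while each configuration with \<open>k \<cdot> \<eta> < \<gamma> s\<close> receives no mass.
  These two facts are dual feasibility and complementary slackness, and by weak linear programming
  duality a feasible \<open>x\<close> satisfying them together with some \<open>\<eta>\<close> is optimal. Hence each joint cluster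
  point of \<open>(x, \<eta>)\<close> lies in \<open>lp_optima \<times> dual_optima\<close> (lemma \<open>cluster_point_optimal\<close>). Both families
  are bounded in finitely many coordinates, so this already gives convergence to the two sets
  (lemma \<open>euclid_dist_set_tendsto_0\<close>).

  Monotonicity of the configuration sets supplies the sign constraint \<open>\<eta> i \<ge> 0\<close> and the lower
  bound on \<open>\<eta>\<close>. Removing one customer of type \<open>i\<close> from \<open>k\<close> leaves a configuration, whose
  weight \<open>a s * exp (k \<cdot> \<nu>)\<close> is bounded too. So the mass of every \<open>k\<close> that contains \<open>i\<close> is at
  most a constant times \<open>exp (\<nu> i)\<close>, and since these masses, weighted by \<open>k i\<close>, add up to
  \<open>\<rho> i > 0\<close>, \<open>\<nu> i\<close> is bounded below uniformly in \<open>\<alpha>\<close> (lemma \<open>multipliers_bounded_below\<close>). Division by \<open>t\<close> turns this into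
  a lower bound that vanishes in the limit.

  The multipliers themselves are found as a maximizer of the concave dual function
  \<open>\<rho> \<cdot> \<nu> - (\<Sum>(k, s). a s / config_fact k * exp (k \<cdot> \<nu>))\<close>, whose stationarity condition is that the
  exponential family has moments \<open>\<rho>\<close> (lemma \<open>exponential_family_moments_exist\<close>). The Gibbs
  inequality then identifies the resulting point as the only minimizer of the entropy
  (lemma \<open>exponential_family_minimizes_entropy\<close>).
\<close>

section \<open>Exponential families with prescribed moments\<close>

text \<open>
  The one-variable bound behind the coercivity of the dual function: for negative \<open>u\<close> the linear
  term decays by itself, for positive \<open>u\<close> the quadratic part of \<open>exp\<close> dominates \<open>2 * \<rho> * u\<close>.
\<close>

lemma linear_minus_exp_le:
  fixes \<rho> b u :: real
  assumes "\<rho> > 0" "b > 0"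
  shows "\<rho> * u - b * exp u \<le> 2 * \<rho>\<^sup>2 / b - \<rho> * \<bar>u\<bar>"
proof (cases "u \<le> 0")
  case True
  have "0 \<le> 2 * \<rho>\<^sup>2 / b" "0 \<le> b * exp u" using assms by auto
  then show ?thesis using True by simp
next
  case False
  have "1 + u + u\<^sup>2 / 2 \<le> exp u" using False by (intro exp_lower_Taylor_quadratic) simp
  then have "u\<^sup>2 / 2 \<le> exp u" using False by linarith
  then have e: "b * (u\<^sup>2 / 2) \<le> b * exp u" using assms by (intro mult_left_mono) auto
  have "0 \<le> (b * u - 2 * \<rho>)\<^sup>2 / (2 * b)" using assms by simp
  also have "\<dots> = b * (u\<^sup>2 / 2) - 2 * \<rho> * u + 2 * \<rho>\<^sup>2 / b"
    using assms by (simp add: field_simps power2_eq_square)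
  finally show ?thesis using e False by simp
qed

text \<open>
  The dual function \<open>D\<close> below is differentiable, and its partial derivatives are the differences
  between \<open>\<rho>\<close> and the moments, so a maximizer solves the moment equations. The unit rows of \<open>A\<close> make
  each \<open>exp (\<nu> i)\<close> appear in \<open>D\<close> on its own, so \<open>D\<close> is coercive and the maximum is attained.
\<close>

lemma exponential_family_moments_exist:
  fixes A :: "'j \<Rightarrow> 'i::finite \<Rightarrow> real" and \<rho> :: "'i \<Rightarrow> real"
  assumes fin: "finite J" and w: "\<And>j. j \<in> J \<Longrightarrow> w j > 0" and \<rho>: "\<And>i. \<rho> i > 0"
    and unit: "\<And>i. \<exists>j\<in>J. \<forall>l. A j l = (if l = i then 1 else 0)"
  shows "\<exists>\<nu>. \<forall>i. (\<Sum>j\<in>J. A j i * (w j * exp (\<Sum>l\<in>UNIV. A j l * \<nu> l))) = \<rho> i"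
proof -
  define E where "E \<nu> = (\<Sum>j\<in>J. w j * exp (\<Sum>l\<in>UNIV. A j l * \<nu> l))" for \<nu>
  define D where "D \<nu> = (\<Sum>l\<in>UNIV. \<rho> l * \<nu> l) - E \<nu>" for \<nu>
  obtain u where uJ: "\<And>i. u i \<in> J" and u: "\<And>i l. A (u i) l = (if l = i then 1 else 0)"
    using unit by metis
  \<comment> \<open>Each unit row bounds \<open>E\<close> from below by itself; averaging these bounds gives the weight \<open>b i\<close>.\<close>
  define b where "b i = w (u i) / real CARD('i)" for i
  have b: "b i > 0" for i using w uJ by (simp add: b_def)
  have E_ge: "w (u i) * exp (\<nu> i) \<le> E \<nu>" for i \<nu>
  proof -
    have "(\<Sum>l\<in>UNIV. A (u i) l * \<nu> l) = \<nu> i"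
      by (simp add: u if_distrib[of "\<lambda>x. x * _"] cong: if_cong)
    then have "w (u i) * exp (\<nu> i) = w (u i) * exp (\<Sum>l\<in>UNIV. A (u i) l * \<nu> l)" by simp
    also have "\<dots> \<le> E \<nu>"
      unfolding E_def using fin uJ w
      by (intro member_le_sum[where f = "\<lambda>j. w j * exp (\<Sum>l\<in>UNIV. A j l * \<nu> l)"]) (auto simp: less_imp_le)
    finally show ?thesis .
  qed
  have D_le: "D \<nu> \<le> (\<Sum>i\<in>UNIV. 2 * (\<rho> i)\<^sup>2 / b i) - (\<Sum>i\<in>UNIV. \<rho> i * \<bar>\<nu> i\<bar>)" for \<nu>
  proof -
    have "(\<Sum>i\<in>UNIV. b i * exp (\<nu> i)) \<le> (\<Sum>i::'i\<in>UNIV. E \<nu> / real CARD('i))"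
      using E_ge by (intro sum_mono) (simp add: b_def divide_right_mono)
    then have "(\<Sum>i\<in>UNIV. b i * exp (\<nu> i)) \<le> E \<nu>" by simp
    then have "D \<nu> \<le> (\<Sum>i\<in>UNIV. \<rho> i * \<nu> i - b i * exp (\<nu> i))"
      by (simp add: D_def sum_subtractf)
    also have "\<dots> \<le> (\<Sum>i\<in>UNIV. 2 * (\<rho> i)\<^sup>2 / b i - \<rho> i * \<bar>\<nu> i\<bar>)"
      using \<rho> b by (intro sum_mono linear_minus_exp_le)
    finally show ?thesis by (simp add: sum_subtractf)
  qed
  \<comment> \<open>\<open>Q\<close> contains the superlevel set of \<open>D\<close> at the origin, so a maximum over \<open>Q\<close> is global.\<close>
  define R where "R = (\<Sum>i\<in>UNIV. 2 * (\<rho> i)\<^sup>2 / b i) - D (\<lambda>_. 0)"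
  define Q where "Q = (\<Pi>\<^sub>E i\<in>UNIV. {- (R / \<rho> i)..R / \<rho> i})"
  have inQ: "\<nu> \<in> Q" if "D \<nu> \<ge> D (\<lambda>_. 0)" for \<nu>
  proof -
    have "\<bar>\<nu> i\<bar> \<le> R / \<rho> i" for i
    proof -
      have "\<rho> i * \<bar>\<nu> i\<bar> \<le> (\<Sum>i\<in>UNIV. \<rho> i * \<bar>\<nu> i\<bar>)"
        using \<rho> by (intro member_le_sum) (auto simp: less_imp_le)
      then show ?thesis using D_le[of \<nu>] that \<rho>[of i] by (simp add: R_def field_simps)
    qed
    then show ?thesis by (force simp: Q_def abs_le_iff)
  qed
  have "compact Q" 
    unfolding Q_def compactin_euclidean_iff[symmetric] euclidean_product_topology[symmetric]
    by (subst compactin_PiE) auto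
  moreover have "Q \<noteq> {}" using inQ by blast
  moreover have "continuous_on Q D"
    unfolding D_def E_def
    by (intro continuous_intros continuous_on_subset[OF continuous_on_product_coordinates]) auto
  ultimately obtain \<nu> where "\<nu> \<in> Q" and \<nu>: "\<And>\<mu>. \<mu> \<in> Q \<Longrightarrow> D \<mu> \<le> D \<nu>"
    using continuous_attains_sup by metis
  have max: "D \<mu> \<le> D \<nu>" for \<mu>
    using inQ[of \<mu>] inQ[of "\<lambda>_. 0"] \<nu> by (meson linear order_trans order_refl)
  have "(\<Sum>j\<in>J. A j i * (w j * exp (\<Sum>l\<in>UNIV. A j l * \<nu> l))) = \<rho> i" for i
  proof -
    define d where "d l = (if l = i then 1 else 0 :: real)" for l
    have d: "((\<lambda>\<tau>. (\<nu>(i := \<tau>)) l) has_real_derivative d l) (at \<tau>)" for l \<tau>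
      by (cases "l = i") (auto simp: d_def)
    have lin: "((\<lambda>\<tau>. \<Sum>l\<in>UNIV. c l * (\<nu>(i := \<tau>)) l) has_real_derivative c i) (at \<tau>)" for c \<tau>
    proof -
      have "((\<lambda>\<tau>. \<Sum>l\<in>UNIV. c l * (\<nu>(i := \<tau>)) l) has_real_derivative (\<Sum>l\<in>UNIV. c l * d l)) (at \<tau>)"
        by (intro DERIV_sum DERIV_cmult d)
      moreover have "(\<Sum>l\<in>UNIV. c l * d l) = c i"
        by (simp add: d_def if_distrib cong: if_cong)
      ultimately show ?thesis by simp
    qed
    have "((\<lambda>\<tau>. D (\<nu>(i := \<tau>))) has_real_derivative
        \<rho> i - (\<Sum>j\<in>J. w j * (exp (\<Sum>l\<in>UNIV. A j l * (\<nu>(i := \<nu> i)) l) * A j i))) (at (\<nu> i))"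
      unfolding D_def E_def
      by (intro DERIV_diff DERIV_sum DERIV_cmult lin DERIV_fun_exp)
    then have "\<rho> i - (\<Sum>j\<in>J. w j * (exp (\<Sum>l\<in>UNIV. A j l * (\<nu>(i := \<nu> i)) l) * A j i)) = 0"
      by (rule DERIV_local_max[of _ _ _ 1]) (use max in auto)
    then show ?thesis by (simp add: ac_simps)
  qed
  then show ?thesis by blast
qed

lemma relative_entropy_term:
  fixes x y :: real
  assumes "x > 0" "y \<ge> 0"
  shows relative_entropy_term_nonneg: "0 \<le> y * ln (y / x) - y + x"
    and relative_entropy_term_eq_0: "y * ln (y / x) - y + x = 0 \<Longrightarrow> y = x"
proof -
  have *: "0 \<le> y * ln (y / x) - y + x \<and> (y * ln (y / x) - y + x = 0 \<longrightarrow> y = x)"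
  proof (cases "y = 0")
    case True
    then show ?thesis using assms by simp
  next
    case False
    then have y: "y > 0" using assms by simp
    have eq: "y * ln (y / x) - y + x = y * ((x / y - 1) - ln (x / y))"
      using y assms by (simp add: ln_div field_simps)
    have "ln (x / y) \<le> x / y - 1" using y assms by (intro ln_le_minus_one) simp
    moreover have "y = x" if "ln (x / y) = x / y - 1"
      using ln_eq_minus_one[OF _ that] y assms by simp
    ultimately show ?thesis unfolding eq using y by auto
  qed
  show "0 \<le> y * ln (y / x) - y + x" using * by blast
  show "y * ln (y / x) - y + x = 0 \<Longrightarrow> y = x" using * by blast
qed

text \<open>
  The moment constraints fix \<open>\<Sum>j. y j * (A j \<cdot> \<nu>)\<close>. Therefore the entropy of an admissible \<open>y\<close>
  is the relative entropy of \<open>y\<close> with respect to \<open>x\<close> up to a constant that does not depend on \<open>y\<close>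
  (\<open>obj\<close> below), and the relative entropy vanishes at \<open>y = x\<close> only. The hypothesis \<open>le\<close> is a
  non-strict inequality so that minimality and uniqueness follow together.
\<close>

lemma exponential_family_minimizes_entropy:
  fixes A :: "'j \<Rightarrow> 'i::finite \<Rightarrow> real" and \<rho> \<nu> :: "'i \<Rightarrow> real"
  assumes fin: "finite J" and w: "\<And>j. j \<in> J \<Longrightarrow> w j > 0"
    and x: "\<And>j. j \<in> J \<Longrightarrow> x j = w j * exp (\<Sum>i\<in>UNIV. A j i * \<nu> i)"
    and mx: "\<And>i. (\<Sum>j\<in>J. A j i * x j) = \<rho> i"
    and y: "\<And>j. j \<in> J \<Longrightarrow> y j \<ge> 0"
    and my: "\<And>i. (\<Sum>j\<in>J. A j i * y j) = \<rho> i"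
    and le: "(\<Sum>j\<in>J. y j * ln (y j / (exp 1 * w j))) \<le> (\<Sum>j\<in>J. x j * ln (x j / (exp 1 * w j)))"
    and j: "j \<in> J"
  shows "y j = x j"
proof -
  have xpos: "x j > 0" if "j \<in> J" for j using x w that by simp
  have pair: "(\<Sum>j\<in>J. z j * (\<Sum>i\<in>UNIV. A j i * \<nu> i)) = (\<Sum>i\<in>UNIV. \<nu> i * \<rho> i)"
    if "\<And>i. (\<Sum>j\<in>J. A j i * z j) = \<rho> i" for z
  proof -
    have "(\<Sum>j\<in>J. z j * (\<Sum>i\<in>UNIV. A j i * \<nu> i)) = (\<Sum>i\<in>UNIV. \<Sum>j\<in>J. \<nu> i * (A j i * z j))"
      unfolding sum_distrib_left by (subst sum.swap) (simp add: ac_simps)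
    then show ?thesis by (simp add: sum_distrib_left[symmetric] that)
  qed
  have obj: "(\<Sum>j\<in>J. z j * ln (z j / (exp 1 * w j)))
      = (\<Sum>j\<in>J. z j * ln (z j / x j) - z j + x j) + (\<Sum>i\<in>UNIV. \<nu> i * \<rho> i) - (\<Sum>j\<in>J. x j)"
    if z: "\<And>j. j \<in> J \<Longrightarrow> z j \<ge> 0" and mz: "\<And>i. (\<Sum>j\<in>J. A j i * z j) = \<rho> i" for z
  proof -
    have "z j * ln (z j / (exp 1 * w j))
        = z j * ln (z j / x j) - z j + x j + z j * (\<Sum>i\<in>UNIV. A j i * \<nu> i) - x j"
      if "j \<in> J" for j
    proof (cases "z j = 0")
      case False
      then have "z j > 0" using z that by force
      then show ?thesis using w[OF that]
        by (simp add: x[OF that] ln_div ln_mult algebra_simps)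
    qed simp
    then show ?thesis
      by (simp add: sum.distrib sum_subtractf pair[OF mz])
  qed
  have "(\<Sum>j\<in>J. y j * ln (y j / x j) - y j + x j) \<le> (\<Sum>j\<in>J. x j * ln (x j / x j) - x j + x j)"
    using le obj[of y] obj[of x] y my mx xpos by (simp add: less_imp_le)
  also have "\<dots> = 0" using xpos by (intro sum.neutral) force
  finally have "(\<Sum>j\<in>J. y j * ln (y j / x j) - y j + x j) = 0"
    using sum_nonneg[of J "\<lambda>j. y j * ln (y j / x j) - y j + x j"] relative_entropy_term_nonneg xpos y
    by (smt (verit))
  then have "\<forall>j\<in>J. y j * ln (y j / x j) - y j + x j = 0"
    using fin relative_entropy_term_nonneg[OF xpos y] by (subst (asm) sum_nonneg_eq_0_iff) auto
  then show ?thesis using j relative_entropy_term_eq_0[OF xpos y] by blast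
qed

section \<open>Distance to a set and cluster points along a filter\<close>

text \<open>
  The Bolzano-Weierstrass theorem, with subfilters in place of subsequences. Applied repeatedly,
  it makes all coordinates of a vector, and then of a second vector, converge along one filter.
\<close>

lemma bounded_convergent_subfilter:
  fixes g :: "'a \<Rightarrow> real"
  assumes G: "G \<noteq> bot" and bdd: "eventually (\<lambda>a. \<bar>g a\<bar> \<le> B) G"
  obtains G' l where "G' \<le> G" "G' \<noteq> bot" "(g \<longlongrightarrow> l) G'"
proof -
  have "eventually (\<lambda>y. y \<in> {-B..B}) (filtermap g G)"
    using bdd by (auto simp: eventually_filtermap abs_le_iff elim!: eventually_mono)
  moreover have "filtermap g G \<noteq> bot" using G by (simp add: filtermap_bot_iff)
  ultimately obtain l where l: "inf (nhds l) (filtermap g G) \<noteq> bot"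
    using compact_Icc[of "-B" B] unfolding compact_filter by blast
  define G' where "G' = inf G (filtercomap g (nhds l))"
  have "G' \<noteq> bot"
  proof
    assume "G' = bot"
    then have "eventually (\<lambda>_. False) G'" by simp
    then obtain P R where P: "eventually P G" and R: "eventually R (nhds l)"
      and PR: "\<And>a. P a \<Longrightarrow> R (g a) \<Longrightarrow> False"
      unfolding G'_def eventually_inf eventually_filtercomap by blast
    have "eventually (\<lambda>y. \<not> R y) (filtermap g G)"
      using P PR by (auto simp: eventually_filtermap elim!: eventually_mono)
    then have "eventually (\<lambda>_. False) (inf (nhds l) (filtermap g G))"
      unfolding eventually_inf using R by blast
    then show False using l by (simp add: eventually_False)
  qed
  moreover have "(g \<longlongrightarrow> l) G'"
    unfolding G'_def by (rule filterlim_mono[OF filterlim_filtercomap order_refl inf_le2])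
  ultimately show ?thesis using that[of G' l] by (simp add: G'_def)
qed

lemma bounded_convergent_subfilter_finite:
  fixes f :: "'a \<Rightarrow> 'j \<Rightarrow> real"
  assumes "finite J" "G \<noteq> bot" "\<And>j. j \<in> J \<Longrightarrow> eventually (\<lambda>a. \<bar>f a j\<bar> \<le> B j) G"
  shows "\<exists>G' l. G' \<le> G \<and> G' \<noteq> bot \<and> (\<forall>j\<in>J. ((\<lambda>a. f a j) \<longlongrightarrow> l j) G')"
  using assms
proof (induction J rule: finite_induct)
  case empty
  then show ?case by auto
next
  case (insert j J)
  then obtain H l where H: "H \<le> G" "H \<noteq> bot" and l: "\<And>i. i \<in> J \<Longrightarrow> ((\<lambda>a. f a i) \<longlongrightarrow> l i) H"
    by (metis insertCI)
  have "eventually (\<lambda>a. \<bar>f a j\<bar> \<le> B j) H" using insert.prems(2)[of j] filter_leD[OF H(1)] by simp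
  then obtain G' m where G': "G' \<le> H" "G' \<noteq> bot" and m: "((\<lambda>a. f a j) \<longlongrightarrow> m) G'"
    using bounded_convergent_subfilter[OF H(2)] by metis
  have "\<forall>i\<in>insert j J. ((\<lambda>a. f a i) \<longlongrightarrow> (l(j := m)) i) G'"
    using m l insert.hyps tendsto_mono[OF G'(1)] by auto
  then show ?case using G' H(1) order_trans by blast
qed

text \<open>
  If the distance did not tend to 0, the parameters at which it is at least some \<open>e > 0\<close> would carry
  a proper subfilter of \<open>F\<close>. A limit in \<open>U\<close> along a finer filter contradicts this.
\<close>

lemma euclid_dist_set_tendsto_0:
  fixes f :: "'a \<Rightarrow> 'j \<Rightarrow> real"
  assumes cluster: "\<And>G. G \<le> F \<Longrightarrow> G \<noteq> bot \<Longrightarrow>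
      \<exists>H y. H \<le> G \<and> H \<noteq> bot \<and> y \<in> U \<and> (\<forall>j\<in>J. ((\<lambda>a. f a j) \<longlongrightarrow> y j) H)"
  shows "((\<lambda>a. euclid_dist_set J (f a) U) \<longlongrightarrow> 0) F"
proof (rule order_tendstoI)
  fix e :: ereal assume "e < 0"
  moreover have "0 \<le> euclid_dist_set J (f a) U" for a
    unfolding euclid_dist_set_def by (intro INF_greatest) (simp add: L2_set_nonneg)
  ultimately show "eventually (\<lambda>a. e < euclid_dist_set J (f a) U) F"
    by (intro always_eventually allI) (rule less_le_trans)
next
  fix e :: ereal assume e: "0 < e"
  define far where "far = {a. \<not> euclid_dist_set J (f a) U < e}"
  show "eventually (\<lambda>a. euclid_dist_set J (f a) U < e) F"
  proof (rule ccontr)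
    assume "\<not> ?thesis"
    then have "inf F (principal far) \<noteq> bot"
      by (auto simp: far_def trivial_limit_def eventually_inf_principal)
    then obtain H y where H: "H \<le> inf F (principal far)" "H \<noteq> bot" and y: "y \<in> U"
      and lim: "\<And>j. j \<in> J \<Longrightarrow> ((\<lambda>a. f a j) \<longlongrightarrow> y j) H"
      using cluster[of "inf F (principal far)"] by auto
    have "((\<lambda>a. L2_set (\<lambda>j. f a j - y j) J) \<longlongrightarrow> sqrt (\<Sum>j\<in>J. (y j - y j)\<^sup>2)) H"
      unfolding L2_set_def by (intro tendsto_intros lim)
    then have "((\<lambda>a. ereal (L2_set (\<lambda>j. f a j - y j) J)) \<longlongrightarrow> ereal 0) H"
      by (intro tendsto_intros) simp
    then have "eventually (\<lambda>a. ereal (L2_set (\<lambda>j. f a j - y j) J) < e) H"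
      using e by (intro order_tendstoD(2)) (auto simp: zero_ereal_def)
    then have "eventually (\<lambda>a. euclid_dist_set J (f a) U < e) H"
      by (rule eventually_mono) (auto simp: euclid_dist_set_def intro: le_less_trans[OF INF_lower[OF y]])
    moreover have "eventually (\<lambda>a. a \<in> far) H"
      using H(1) by (simp add: le_principal)
    ultimately have "eventually (\<lambda>_. False) H"
      by eventually_elim (simp add: far_def)
    then show False using H(2) by (simp add: eventually_False)
  qed
qed

section \<open>The entropy minimizer and its multipliers\<close>

locale configurations =
  fixes Kbar :: "'s::finite \<Rightarrow> ('i::finite \<Rightarrow> nat) set"
    and \<rho> :: "'i \<Rightarrow> real" and \<gamma> :: "'s \<Rightarrow> real"
  assumes finite_Kbar: "\<And>s. finite (Kbar s)"
    and Kbar_down: "\<And>s k k'. k \<in> Kbar s \<Longrightarrow> (\<And>i. k' i \<le> k i) \<Longrightarrow> k' \<in> Kbar s"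
    and unit_config: "\<And>i. \<exists>s. (\<lambda>j. if j = i then 1 else 0) \<in> Kbar s"
    and \<rho>_pos: "\<And>i. \<rho> i > 0"
    and \<gamma>_pos: "\<And>s. \<gamma> s > 0"
begin

abbreviation "\<K> \<equiv> all_configs Kbar"

definition load :: "('i \<Rightarrow> nat) \<Rightarrow> ('i \<Rightarrow> real) \<Rightarrow> real" where
  "load k \<nu> = (\<Sum>i\<in>UNIV. real (k i) * \<nu> i)"

lemma finite_configs: "finite \<K>"
proof -
  have "\<K> \<subseteq> (\<Union>s. Kbar s) \<times> UNIV" by (auto simp: all_configs_def nz_configs_def)
  then show ?thesis by (rule finite_subset) (simp add: finite_Kbar)
qed

lemma sum_configs:
  fixes f :: "('i \<Rightarrow> nat) \<times> 's \<Rightarrow> real"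
  shows "(\<Sum>s\<in>UNIV. \<Sum>k\<in>nz_configs Kbar s. f (k, s)) = sum f \<K>"
proof -
  have "(\<Sum>s\<in>UNIV. \<Sum>k\<in>nz_configs Kbar s. f (k, s))
      = (\<Sum>(s, k)\<in>Sigma UNIV (nz_configs Kbar). f (k, s))"
    by (rule sum.Sigma) (auto simp: nz_configs_def finite_Kbar)
  also have "\<dots> = sum f \<K>"
    by (rule sum.reindex_bij_witness[of _ prod.swap prod.swap]) (auto simp: all_configs_def)
  finally show ?thesis .
qed

lemma unit_config_mem:
  obtains s where "(\<lambda>j. if j = i then 1 else 0, s) \<in> \<K>"
proof -
  obtain s where "(\<lambda>j. if j = i then 1 else 0) \<in> Kbar s" using unit_config by blast
  moreover have "(\<lambda>j. if j = i then 1 else 0 :: nat) \<noteq> (\<lambda>_. 0)" by (metis zero_neq_one)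
  ultimately show ?thesis using that by (auto simp: all_configs_def nz_configs_def)
qed

lemma load_unit: "load (\<lambda>j. if j = i then 1 else 0) \<nu> = \<nu> i"
proof -
  have "(\<lambda>j. real (if j = i then 1 else 0) * \<nu> j) = (\<lambda>j. if j = i then \<nu> j else 0)" by auto
  then have "load (\<lambda>j. if j = i then 1 else 0) \<nu> = (\<Sum>j\<in>UNIV. if j = i then \<nu> j else 0)"
    unfolding load_def by (rule arg_cong)
  then show ?thesis by simp
qed

lemma config_fact_ge_1: "1 \<le> config_fact (k :: 'i \<Rightarrow> nat)"
  unfolding config_fact_def by (intro prod_ge_1) simp

lemma feasible_iff:
  "x \<in> feasible Kbar \<rho> \<longleftrightarrow> x \<in> \<K> \<rightarrow>\<^sub>E {0..} \<and> (\<forall>i. (\<Sum>p\<in>\<K>. real (fst p i) * x p) = \<rho> i)"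
  by (simp add: feasible_def case_prod_beta)

text \<open>
  The configurations with one customer are the unit rows that solvability of the moment
  equations asks for.
\<close>

lemma exponential_feasible_exists:
  assumes a: "\<And>s. a s > 0"
  obtains x \<nu> where "x \<in> feasible Kbar \<rho>"
    and "\<And>k s. (k, s) \<in> \<K> \<Longrightarrow> x (k, s) = a s / config_fact k * exp (load k \<nu>)"
proof -
  define w where "w p = a (snd p) / config_fact (fst p)" for p :: "('i \<Rightarrow> nat) \<times> 's"
  have w: "w p > 0" for p
    using a config_fact_ge_1[of "fst p"] by (simp add: w_def)
  have "\<exists>p\<in>\<K>. \<forall>l. real (fst p l) = (if l = i then 1 else 0)" for i
    by (rule unit_config_mem[of i]) force
  then obtain \<nu> where \<nu>: "\<And>i. (\<Sum>p\<in>\<K>. real (fst p i) * (w p * exp (load (fst p) \<nu>))) = \<rho> i"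
    using exponential_family_moments_exist[where J = \<K> and w = w and \<rho> = \<rho>
        and A = "\<lambda>p i. real (fst p i)"] finite_configs w \<rho>_pos
    unfolding load_def by blast
  define x where "x = restrict (\<lambda>p. w p * exp (load (fst p) \<nu>)) \<K>"
  have "x \<in> feasible Kbar \<rho>"
    using w by (auto simp: feasible_iff x_def \<nu> less_imp_le)
  moreover have "x (k, s) = a s / config_fact k * exp (load k \<nu>)" if "(k, s) \<in> \<K>" for k s
    using that by (simp add: x_def w_def)
  ultimately show ?thesis using that by blast
qed

lemma entropy_obj_eq:
  "entropy_obj Kbar a x = (\<Sum>p\<in>\<K>. x p * ln (x p / (exp 1 * (a (snd p) / config_fact (fst p)))))"
  unfolding entropy_obj_def
  using sum_configs[of "\<lambda>p. x p * ln (x p / (exp 1 * (a (snd p) / config_fact (fst p))))"] by simp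

text \<open>
  These two facts are all that is used of the definite descriptions in \<^const>\<open>x_star\<close> and
  \<^const>\<open>nu_star\<close>. The multipliers are unique because the single-customer configuration of type
  \<open>i\<close> determines \<open>exp (\<nu> i)\<close>.
\<close>

lemma x_star_feasible_exponential:
  assumes a: "\<And>s. a s > 0"
  shows x_star_feasible: "x_star Kbar \<rho> a \<in> feasible Kbar \<rho>"
    and x_star_exponential: "\<And>k s. (k, s) \<in> \<K> \<Longrightarrow>
      x_star Kbar \<rho> a (k, s) = a s / config_fact k * exp (load k (nu_star Kbar \<rho> a))"
proof -
  obtain x \<nu> where x: "x \<in> feasible Kbar \<rho>"
    and x_eq: "\<And>k s. (k, s) \<in> \<K> \<Longrightarrow> x (k, s) = a s / config_fact k * exp (load k \<nu>)"
    using exponential_feasible_exists[where a = a, OF a] by metis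
  have uniq: "y = x" if y: "y \<in> feasible Kbar \<rho>" and le: "entropy_obj Kbar a y \<le> entropy_obj Kbar a x" for y
  proof (rule PiE_ext)
    show "y \<in> \<K> \<rightarrow>\<^sub>E {0..}" "x \<in> \<K> \<rightarrow>\<^sub>E {0..}" using x y by (auto simp: feasible_iff)
    fix p assume p: "p \<in> \<K>"
    show "y p = x p"
    proof (rule exponential_family_minimizes_entropy[where J = \<K> and \<rho> = \<rho> and \<nu> = \<nu>
          and A = "\<lambda>p i. real (fst p i)" and w = "\<lambda>p. a (snd p) / config_fact (fst p)"])
      show "0 < a (snd p) / config_fact (fst p)" for p :: "('i \<Rightarrow> nat) \<times> 's"
        using a config_fact_ge_1[of "fst p"] by simp
      show "x q = a (snd q) / config_fact (fst q) * exp (\<Sum>i\<in>UNIV. real (fst q i) * \<nu> i)"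
        if "q \<in> \<K>" for q using x_eq[of "fst q" "snd q"] that by (simp add: load_def)
    qed (use x y p le finite_configs in \<open>auto simp: feasible_iff entropy_obj_eq PiE_iff\<close>)
  qed
  have "is_arg_min (entropy_obj Kbar a) (\<lambda>y. y \<in> feasible Kbar \<rho>) x"
    using x uniq by (force simp: is_arg_min_def)
  moreover have "y = x" if "is_arg_min (entropy_obj Kbar a) (\<lambda>y. y \<in> feasible Kbar \<rho>) y" for y
    using that x uniq[of y] by (force simp: is_arg_min_def not_less)
  ultimately have xs: "x_star Kbar \<rho> a = x"
    unfolding x_star_def by (rule the_equality)
  then show "x_star Kbar \<rho> a \<in> feasible Kbar \<rho>" using x by simp
  define mult where "mult \<mu> \<longleftrightarrow> (\<forall>s. \<forall>k\<in>nz_configs Kbar s.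
       x_star Kbar \<rho> a (k, s) = a s / config_fact k * exp (\<Sum>i\<in>UNIV. real (k i) * \<mu> i))" for \<mu>
  have mult: "x (k, s) = a s / config_fact k * exp (load k \<mu>)" if "mult \<mu>" "(k, s) \<in> \<K>" for \<mu> k s
    using that by (simp add: mult_def all_configs_def xs load_def)
  have "nu_star Kbar \<rho> a = \<nu>"
    unfolding nu_star_def mult_def[symmetric]
  proof (rule the_equality)
    show "mult \<nu>" using x_eq by (simp add: mult_def all_configs_def xs load_def)
  next
    fix \<mu> assume \<mu>: "mult \<mu>"
    show "\<mu> = \<nu>"
    proof
      fix i
      let ?k = "\<lambda>j :: 'i. if j = i then 1 else 0 :: nat"
      obtain s where s: "(?k, s) \<in> \<K>" by (rule unit_config_mem)
      show "\<mu> i = \<nu> i"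
        using mult[OF \<mu> s] x_eq[OF s] a[of s] config_fact_ge_1[of ?k] unfolding load_unit by simp
    qed
  qed
  then show "x_star Kbar \<rho> a (k, s) = a s / config_fact k * exp (load k (nu_star Kbar \<rho> a))"
    if "(k, s) \<in> \<K>" for k s using x_eq[OF that] xs by simp
qed

section \<open>Bounds uniform in the parameter\<close>

abbreviation "weights \<alpha> \<equiv> (\<lambda>s. \<alpha> powr \<gamma> s)"
abbreviation "X \<alpha> \<equiv> x_star Kbar \<rho> (weights \<alpha>)"
abbreviation "\<N> \<alpha> \<equiv> nu_star Kbar \<rho> (weights \<alpha>)"
definition "\<eta> \<alpha> i = inverse (- ln \<alpha>) * \<N> \<alpha> i"

text \<open>A nonzero configuration contains some type \<open>i\<close>, hence its mass is counted in \<open>\<rho> i\<close>.\<close>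

lemma feasible_le:
  assumes x: "x \<in> feasible Kbar \<rho>" and p: "p \<in> \<K>"
  shows "x p \<le> sum \<rho> UNIV"
proof -
  obtain i where i: "fst p i \<noteq> 0"
    using p by (auto simp: all_configs_def nz_configs_def fun_eq_iff)
  have nn: "\<And>q. q \<in> \<K> \<Longrightarrow> 0 \<le> x q" using x by (auto simp: feasible_iff PiE_iff)
  have "x p \<le> real (fst p i) * x p"
    using i nn[OF p] by (simp add: mult_le_cancel_right1)
  also have "\<dots> \<le> (\<Sum>q\<in>\<K>. real (fst q i) * x q)"
    using p finite_configs nn by (intro member_le_sum) auto
  also have "\<dots> = \<rho> i" using x by (simp add: feasible_iff)
  also have "\<dots> \<le> sum \<rho> UNIV" using \<rho>_pos by (intro member_le_sum) (auto simp: less_imp_le)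
  finally show ?thesis .
qed

text \<open>
  For a nonzero configuration the left-hand side is \<open>config_fact k\<close> times a bounded mass. The zero
  configuration, for which it is \<open>\<alpha> powr \<gamma> s \<le> 1\<close>, is included because it arises when the only
  customer is removed from a single-customer configuration.
\<close>

lemma weighted_exp_load_bounded:
  obtains M where "M \<ge> 1"
    "\<And>\<alpha> s k. 0 < \<alpha> \<Longrightarrow> \<alpha> < 1 \<Longrightarrow> k \<in> Kbar s \<Longrightarrow> \<alpha> powr \<gamma> s * exp (load k (\<N> \<alpha>)) \<le> M"
proof -
  define M where "M = 1 + (\<Sum>p\<in>\<K>. config_fact (fst p) * sum \<rho> UNIV)"
  have nn: "0 \<le> config_fact k * sum \<rho> UNIV" for k :: "'i \<Rightarrow> nat"
    using config_fact_ge_1[of k] \<rho>_pos by (intro mult_nonneg_nonneg sum_nonneg) (auto simp: less_imp_le)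
  then have "M \<ge> 1" unfolding M_def by (simp add: sum_nonneg)
  moreover have "\<alpha> powr \<gamma> s * exp (load k (\<N> \<alpha>)) \<le> M"
    if \<alpha>: "0 < \<alpha>" "\<alpha> < 1" and k: "k \<in> Kbar s" for \<alpha> s k
  proof (cases "k = (\<lambda>_. 0)")
    case True
    have "\<alpha> powr \<gamma> s \<le> 1" using \<alpha> \<gamma>_pos[of s] by (intro powr_le1) auto
    then show ?thesis using True \<open>M \<ge> 1\<close> by (simp add: load_def)
  next
    case False
    then have p: "(k, s) \<in> \<K>" using k by (simp add: all_configs_def nz_configs_def)
    have "\<alpha> powr \<gamma> s * exp (load k (\<N> \<alpha>)) = config_fact k * X \<alpha> (k, s)"
      using x_star_exponential[of "weights \<alpha>", OF _ p] \<alpha> config_fact_ge_1[of k] by simp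
    also have "\<dots> \<le> config_fact k * sum \<rho> UNIV"
      using feasible_le[OF x_star_feasible[of "weights \<alpha>"] p] \<alpha> config_fact_ge_1[of k]
      by (intro mult_left_mono) auto
    also have "\<dots> \<le> (\<Sum>p\<in>\<K>. config_fact (fst p) * sum \<rho> UNIV)"
      using member_le_sum[OF p, of "\<lambda>p. config_fact (fst p) * sum \<rho> UNIV"] nn finite_configs by simp
    finally show ?thesis by (simp add: M_def)
  qed
  ultimately show ?thesis using that by blast
qed

lemma load_remove_one:
  assumes "k i \<noteq> 0"
  shows "load k \<nu> = \<nu> i + load (k(i := k i - 1)) \<nu>"
proof -
  have "load k \<nu> = (\<Sum>j\<in>UNIV. (if j = i then \<nu> j else 0) + real ((k(i := k i - 1)) j) * \<nu> j)"
    unfolding load_def using assms by (intro sum.cong) (auto simp: algebra_simps of_nat_diff)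
  then show ?thesis by (simp add: sum.distrib load_def)
qed

text \<open>
  If \<open>\<nu> i\<close> were very negative, every configuration that contains \<open>i\<close> would have small mass,
  because its mass is at most \<open>exp (\<nu> i)\<close> times the bounded weight of the configuration with one
  customer of type \<open>i\<close> fewer. But the total load of type \<open>i\<close> is \<open>\<rho> i > 0\<close>.
\<close>

lemma multipliers_bounded_below:
  "\<exists>m. \<forall>\<alpha>. 0 < \<alpha> \<longrightarrow> \<alpha> < 1 \<longrightarrow> m \<le> \<N> \<alpha> i"
proof -
  obtain M where M: "M \<ge> 1"
    "\<And>\<alpha> s k. 0 < \<alpha> \<Longrightarrow> \<alpha> < 1 \<Longrightarrow> k \<in> Kbar s \<Longrightarrow> \<alpha> powr \<gamma> s * exp (load k (\<N> \<alpha>)) \<le> M"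
    using weighted_exp_load_bounded by blast
  define C where "C = (\<Sum>p\<in>\<K>. real (fst p i)) * M"
  have main: "\<rho> i \<le> C * exp (\<N> \<alpha> i)" if \<alpha>: "0 < \<alpha>" "\<alpha> < 1" for \<alpha>
  proof -
    have "real (k i) * X \<alpha> (k, s) \<le> real (k i) * M * exp (\<N> \<alpha> i)" if p: "(k, s) \<in> \<K>" for k s
    proof (cases "k i = 0")
      case False
      let ?k = "k(i := k i - 1)"
      have "k \<in> Kbar s" using p by (simp add: all_configs_def nz_configs_def)
      then have k: "?k \<in> Kbar s" by (rule Kbar_down) simp
      have "X \<alpha> (k, s) = \<alpha> powr \<gamma> s * exp (load k (\<N> \<alpha>)) / config_fact k"
        using x_star_exponential[of "weights \<alpha>", OF _ p] \<alpha> by simp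
      also have "\<dots> \<le> \<alpha> powr \<gamma> s * exp (load k (\<N> \<alpha>)) / 1"
        using config_fact_ge_1[of k] by (intro divide_left_mono) auto
      also have "\<dots> = \<alpha> powr \<gamma> s * exp (load k (\<N> \<alpha>))" by simp
      also have "\<dots> = \<alpha> powr \<gamma> s * exp (load ?k (\<N> \<alpha>)) * exp (\<N> \<alpha> i)"
        by (simp add: load_remove_one[where k = k and i = i, OF False] exp_add)
      also have "\<dots> \<le> M * exp (\<N> \<alpha> i)"
        using M(2)[OF \<alpha> k] by (intro mult_right_mono) auto
      finally show ?thesis by (simp add: mult.assoc mult_left_mono)
    qed simp
    then have "(\<Sum>p\<in>\<K>. real (fst p i) * X \<alpha> p) \<le> (\<Sum>p\<in>\<K>. real (fst p i) * M * exp (\<N> \<alpha> i))"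
      by (intro sum_mono) auto
    moreover have "(\<Sum>p\<in>\<K>. real (fst p i) * X \<alpha> p) = \<rho> i"
      using x_star_feasible[of "weights \<alpha>"] \<alpha> by (simp add: feasible_iff)
    ultimately show ?thesis by (simp add: C_def sum_distrib_right)
  qed
  have "0 < C * exp (\<N> (1/2) i)" using main[of "1/2"] \<rho>_pos[of i] by simp
  then have "C > 0" by (simp add: zero_less_mult_iff)
  have "ln (\<rho> i / C) \<le> \<N> \<alpha> i" if "0 < \<alpha>" "\<alpha> < 1" for \<alpha>
  proof -
    have "\<rho> i / C \<le> exp (\<N> \<alpha> i)"
      using main[OF that] \<open>C > 0\<close> by (simp add: divide_le_eq mult.commute)
    then have "ln (\<rho> i / C) \<le> ln (exp (\<N> \<alpha> i))"
      using \<open>C > 0\<close> \<rho>_pos[of i] by (subst ln_le_cancel_iff) auto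
    then show ?thesis by simp
  qed
  then show ?thesis by blast
qed

section \<open>Cluster points and complementary slackness\<close>

lemma load_scaled: "load k (\<eta> \<alpha>) = load k (\<N> \<alpha>) / (- ln \<alpha>)"
  by (simp add: load_def \<eta>_def divide_inverse sum_distrib_left ac_simps)

lemma load_scaled_le:
  assumes "M \<ge> 1" "0 < \<alpha>" "\<alpha> < 1" "\<alpha> powr \<gamma> s * exp (load k (\<N> \<alpha>)) \<le> M"
  shows "load k (\<eta> \<alpha>) \<le> \<gamma> s + ln M / (- ln \<alpha>)"
proof -
  have t: "- ln \<alpha> > 0" using assms by simp
  have "exp (\<gamma> s * ln \<alpha> + load k (\<N> \<alpha>)) \<le> M" using assms by (simp add: powr_def exp_add)
  then have "\<gamma> s * ln \<alpha> + load k (\<N> \<alpha>) \<le> ln M" using assms(1) by (subst ln_ge_iff) auto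
  then have "load k (\<N> \<alpha>) / (- ln \<alpha>) \<le> (\<gamma> s * (- ln \<alpha>) + ln M) / (- ln \<alpha>)"
    using t by (intro divide_right_mono) auto
  also have "\<dots> = \<gamma> s + ln M / (- ln \<alpha>)" using t by (simp add: field_simps)
  finally show ?thesis by (simp add: load_scaled)
qed

text \<open>
  Weak duality: the value \<open>\<Sum>i. h i * \<rho> i\<close> is a lower bound for the cost of every feasible point, and
  complementary slackness says that \<open>x\<close> attains it.
\<close>

lemma complementary_slackness_optimal:
  assumes x: "x \<in> feasible Kbar \<rho>"
    and dual: "\<And>k s. (k, s) \<in> \<K> \<Longrightarrow> load k h \<le> \<gamma> s"
    and slack: "\<And>k s. (k, s) \<in> \<K> \<Longrightarrow> load k h < \<gamma> s \<Longrightarrow> x (k, s) = 0"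
  shows "x \<in> lp_optima Kbar \<rho> \<gamma>"
proof -
  have ws: "weighted_servers Kbar \<gamma> y = (\<Sum>p\<in>\<K>. \<gamma> (snd p) * y p)" for y
    unfolding weighted_servers_def using sum_configs[of "\<lambda>p. \<gamma> (snd p) * y p"] by simp
  have val: "(\<Sum>p\<in>\<K>. load (fst p) h * y p) = (\<Sum>i\<in>UNIV. h i * \<rho> i)"
    if "y \<in> feasible Kbar \<rho>" for y
  proof -
    have "(\<Sum>p\<in>\<K>. load (fst p) h * y p) = (\<Sum>i\<in>UNIV. \<Sum>p\<in>\<K>. h i * (real (fst p i) * y p))"
      unfolding load_def sum_distrib_right by (subst sum.swap) (simp add: ac_simps)
    then show ?thesis using that by (simp add: sum_distrib_left[symmetric] feasible_iff)
  qed
  have "weighted_servers Kbar \<gamma> x \<le> weighted_servers Kbar \<gamma> y" if y: "y \<in> feasible Kbar \<rho>" for y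
  proof -
    have "\<gamma> (snd p) * x p = load (fst p) h * x p" if "p \<in> \<K>" for p
      using dual[of "fst p" "snd p"] slack[of "fst p" "snd p"] that by fastforce
    then have "weighted_servers Kbar \<gamma> x = (\<Sum>p\<in>\<K>. load (fst p) h * x p)"
      unfolding ws by (rule sum.cong[OF refl])
    also have "\<dots> = (\<Sum>p\<in>\<K>. load (fst p) h * y p)" using val x y by simp
    also have "\<dots> \<le> weighted_servers Kbar \<gamma> y"
      unfolding ws using y dual by (intro sum_mono mult_right_mono) (auto simp: feasible_iff PiE_iff)
    finally show ?thesis .
  qed
  then show ?thesis using x by (force simp: lp_optima_def is_arg_min_def not_less)
qed

lemma minus_ln_at_top: "filterlim (\<lambda>\<alpha>::real. - ln \<alpha>) at_top (at_right 0)"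
  using ln_at_0 by (simp add: filterlim_uminus_at_top)

lemma eventually_small: "eventually (\<lambda>\<alpha>::real. 0 < \<alpha> \<and> \<alpha> < exp (- 1)) (at_right 0)"
  by (auto simp: eventually_at_right_field intro!: exI[of _ "exp (- 1)"])

lemma scaled_multipliers_bounded:
  "\<exists>B. eventually (\<lambda>\<alpha>. \<bar>\<eta> \<alpha> i\<bar> \<le> B) (at_right 0)"
proof -
  obtain M where M: "M \<ge> 1"
    "\<And>\<alpha> s k. 0 < \<alpha> \<Longrightarrow> \<alpha> < 1 \<Longrightarrow> k \<in> Kbar s \<Longrightarrow> \<alpha> powr \<gamma> s * exp (load k (\<N> \<alpha>)) \<le> M"
    using weighted_exp_load_bounded by blast
  obtain m where m: "\<And>\<alpha>. 0 < \<alpha> \<Longrightarrow> \<alpha> < 1 \<Longrightarrow> m \<le> \<N> \<alpha> i"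
    using multipliers_bounded_below by blast
  obtain s where s: "(\<lambda>j. if j = i then 1 else 0) \<in> Kbar s" using unit_config by blast
  have "\<bar>\<eta> \<alpha> i\<bar> \<le> \<bar>m\<bar> + \<gamma> s + ln M" if \<alpha>: "0 < \<alpha>" "\<alpha> < exp (- 1)" for \<alpha>
  proof -
    have "\<alpha> < 1" using \<alpha> by (smt (verit) one_less_exp_iff exp_less_one_iff)
    have "ln \<alpha> < - 1" using \<alpha> by (metis ln_exp ln_less_cancel_iff exp_gt_zero)
    then have t: "- ln \<alpha> \<ge> 1" by simp
    have "\<eta> \<alpha> i \<le> \<gamma> s + ln M / (- ln \<alpha>)"
      using load_scaled_le[OF M(1) \<alpha>(1) \<open>\<alpha> < 1\<close> M(2)[OF \<alpha>(1) \<open>\<alpha> < 1\<close> s]] unfolding load_unit .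
    also have "ln M / (- ln \<alpha>) \<le> ln M / 1"
      using t M(1) by (intro divide_left_mono) auto
    finally have up: "\<eta> \<alpha> i \<le> \<gamma> s + ln M" by simp
    have "- \<bar>m\<bar> \<le> - (\<bar>m\<bar> / (- ln \<alpha>))"
      using divide_left_mono[of 1 "- ln \<alpha>" "\<bar>m\<bar>"] t by simp
    also have "\<dots> = - \<bar>m\<bar> / (- ln \<alpha>)" by simp
    also have "\<dots> \<le> \<N> \<alpha> i / (- ln \<alpha>)"
      using m[OF \<alpha>(1) \<open>\<alpha> < 1\<close>] t by (intro divide_right_mono) auto
    also have "\<dots> = \<eta> \<alpha> i" by (simp add: \<eta>_def divide_inverse)
    finally have lo: "- \<bar>m\<bar> \<le> \<eta> \<alpha> i" .
    have "0 \<le> ln M" using M(1) by simp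
    then show ?thesis using up lo \<gamma>_pos[of s] unfolding abs_le_iff by linarith
  qed
  then show ?thesis using eventually_small by (blast intro: eventually_mono)
qed

text \<open>
  One filter \<open>H\<close> must serve for both limits: membership of \<open>h\<close> in the dual set is witnessed by the
  limit \<open>x\<close>, and optimality of \<open>x\<close> is certified by \<open>h\<close>.
\<close>

lemma cluster_point_optimal:
  assumes G: "G \<le> at_right 0" "G \<noteq> bot"
  shows "\<exists>H x h. H \<le> G \<and> H \<noteq> bot \<and> x \<in> lp_optima Kbar \<rho> \<gamma> \<and> h \<in> dual_optima Kbar \<rho> \<gamma> \<and>
    (\<forall>p\<in>\<K>. ((\<lambda>\<alpha>. X \<alpha> p) \<longlongrightarrow> x p) H) \<and> (\<forall>i. ((\<lambda>\<alpha>. \<eta> \<alpha> i) \<longlongrightarrow> h i) H)"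
proof -
  obtain B where "\<And>i. eventually (\<lambda>\<alpha>. \<bar>\<eta> \<alpha> i\<bar> \<le> B i) (at_right 0)"
    using scaled_multipliers_bounded by metis
  then have "eventually (\<lambda>\<alpha>. \<bar>\<eta> \<alpha> i\<bar> \<le> B i) G" for i by (rule filter_leD[OF G(1)])
  then obtain G1 h where G1: "G1 \<le> G" "G1 \<noteq> bot" and h1: "\<And>i. ((\<lambda>\<alpha>. \<eta> \<alpha> i) \<longlongrightarrow> h i) G1"
    using bounded_convergent_subfilter_finite[of UNIV G \<eta> B] G(2) by auto
  have feas: "X \<alpha> \<in> feasible Kbar \<rho>" if "0 < \<alpha>" for \<alpha>
    using x_star_feasible[of "weights \<alpha>"] that by simp
  have "eventually (\<lambda>\<alpha>. \<bar>X \<alpha> p\<bar> \<le> sum \<rho> UNIV) (at_right 0)" if p: "p \<in> \<K>" for p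
    using eventually_small
  proof eventually_elim
    case (elim \<alpha>)
    then have "X \<alpha> p \<ge> 0" using feas[of \<alpha>] p by (auto simp: feasible_iff PiE_iff)
    then show ?case using feasible_le[OF feas p] elim by simp
  qed
  then have "eventually (\<lambda>\<alpha>. \<bar>X \<alpha> p\<bar> \<le> sum \<rho> UNIV) G1" if "p \<in> \<K>" for p
    using that filter_leD[OF order_trans[OF G1(1) G(1)]] by blast
  then obtain H l where H: "H \<le> G1" "H \<noteq> bot" and l: "\<And>p. p \<in> \<K> \<Longrightarrow> ((\<lambda>\<alpha>. X \<alpha> p) \<longlongrightarrow> l p) H"
    using bounded_convergent_subfilter_finite[of \<K> G1 X "\<lambda>_. sum \<rho> UNIV"] G1(2) finite_configs by blast
  have H0: "H \<le> at_right 0" using H(1) G1(1) G(1) by (meson order_trans)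
  have h: "((\<lambda>\<alpha>. \<eta> \<alpha> i) \<longlongrightarrow> h i) H" for i by (rule tendsto_mono[OF H(1) h1])
  have small: "eventually (\<lambda>\<alpha>. 0 < \<alpha> \<and> \<alpha> < 1) H"
    using filter_leD[OF H0 eventually_small] by (rule eventually_mono) (smt (verit) exp_less_one_iff)
  have t: "filterlim (\<lambda>\<alpha>. - ln \<alpha>) at_top H"
    by (rule filterlim_mono[OF minus_ln_at_top order_refl H0])
  have vanish: "((\<lambda>\<alpha>. c / (- ln \<alpha>)) \<longlongrightarrow> 0) H" for c :: real
    by (rule real_tendsto_divide_at_top[OF tendsto_const t])
  have load_lim: "((\<lambda>\<alpha>. load k (\<eta> \<alpha>)) \<longlongrightarrow> load k h) H" for k
    unfolding load_def by (intro tendsto_intros h)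
  \<comment> \<open>Feasible points are extensional, whereas \<open>l\<close> is arbitrary outside the configurations.\<close>
  define x where "x = restrict l \<K>"
  have x_lim: "((\<lambda>\<alpha>. X \<alpha> p) \<longlongrightarrow> x p) H" if "p \<in> \<K>" for p using l that by (simp add: x_def)
  have x_feas: "x \<in> feasible Kbar \<rho>"
  proof -
    have "0 \<le> x p" if "p \<in> \<K>" for p
    proof (rule tendsto_lowerbound[OF x_lim[OF that] _ H(2)])
      show "eventually (\<lambda>\<alpha>. 0 \<le> X \<alpha> p) H"
        using small by eventually_elim (use feas that in \<open>auto simp: feasible_iff PiE_iff\<close>)
    qed
    moreover have "(\<Sum>p\<in>\<K>. real (fst p i) * x p) = \<rho> i" for i
    proof (rule tendsto_unique[OF H(2)])
      show "((\<lambda>\<alpha>. \<Sum>p\<in>\<K>. real (fst p i) * X \<alpha> p) \<longlongrightarrow> (\<Sum>p\<in>\<K>. real (fst p i) * x p)) H"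
        by (intro tendsto_intros x_lim)
      have "eventually (\<lambda>\<alpha>. (\<Sum>p\<in>\<K>. real (fst p i) * X \<alpha> p) = \<rho> i) H"
        using small by eventually_elim (use feas in \<open>auto simp: feasible_iff\<close>)
      then show "((\<lambda>\<alpha>. \<Sum>p\<in>\<K>. real (fst p i) * X \<alpha> p) \<longlongrightarrow> \<rho> i) H" by (rule tendsto_eventually)
    qed
    ultimately show ?thesis by (auto simp: feasible_iff x_def)
  qed
  have h_nonneg: "0 \<le> h i" for i
  proof -
    obtain m where m: "\<And>\<alpha>. 0 < \<alpha> \<Longrightarrow> \<alpha> < 1 \<Longrightarrow> m \<le> \<N> \<alpha> i"
      using multipliers_bounded_below by blast
    have "eventually (\<lambda>\<alpha>. m / (- ln \<alpha>) \<le> \<eta> \<alpha> i) H"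
      using small
    proof eventually_elim
      case (elim \<alpha>)
      then have "m / (- ln \<alpha>) \<le> \<N> \<alpha> i / (- ln \<alpha>)" using m by (intro divide_right_mono) auto
      then show ?case by (simp add: \<eta>_def divide_inverse mult.commute)
    qed
    then show ?thesis by (rule tendsto_le[OF H(2) h vanish])
  qed
  have dual: "load k h \<le> \<gamma> s" if "(k, s) \<in> \<K>" for k s
  proof -
    have k: "k \<in> Kbar s" using that by (simp add: all_configs_def nz_configs_def)
    obtain M where M: "M \<ge> 1"
      "\<And>\<alpha> s k. 0 < \<alpha> \<Longrightarrow> \<alpha> < 1 \<Longrightarrow> k \<in> Kbar s \<Longrightarrow> \<alpha> powr \<gamma> s * exp (load k (\<N> \<alpha>)) \<le> M"
      using weighted_exp_load_bounded by blast
    have "eventually (\<lambda>\<alpha>. load k (\<eta> \<alpha>) \<le> \<gamma> s + ln M / (- ln \<alpha>)) H"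
      using small by eventually_elim (use M k load_scaled_le in blast)
    moreover have "((\<lambda>\<alpha>. \<gamma> s + ln M / (- ln \<alpha>)) \<longlongrightarrow> \<gamma> s + 0) H"
      by (intro tendsto_intros vanish)
    ultimately have "load k h \<le> \<gamma> s + 0" using tendsto_le[OF H(2) _ load_lim] by blast
    then show ?thesis by simp
  qed
  \<comment> \<open>The mass is \<open>exp (t * (k \<cdot> \<eta> - \<gamma> s)) / config_fact k\<close>, and here the exponent tends to minus infinity.\<close>
  have slack: "x (k, s) = 0" if p: "(k, s) \<in> \<K>" and lt: "load k h < \<gamma> s" for k s
  proof (rule tendsto_unique[OF H(2) x_lim[OF p]])
    have "((\<lambda>\<alpha>. load k (\<eta> \<alpha>) - \<gamma> s) \<longlongrightarrow> load k h - \<gamma> s) H"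
      by (intro tendsto_intros load_lim)
    then have "filterlim (\<lambda>\<alpha>. (load k (\<eta> \<alpha>) - \<gamma> s) * (- ln \<alpha>)) at_bot H"
      by (rule filterlim_tendsto_neg_mult_at_bot[OF _ _ t]) (use lt in simp)
    then have "((\<lambda>\<alpha>. inverse (config_fact k) * exp ((load k (\<eta> \<alpha>) - \<gamma> s) * (- ln \<alpha>)))
        \<longlongrightarrow> inverse (config_fact k) * 0) H"
      by (intro tendsto_mult_left filterlim_compose[OF exp_at_bot])
    moreover have "eventually (\<lambda>\<alpha>. inverse (config_fact k) * exp ((load k (\<eta> \<alpha>) - \<gamma> s) * (- ln \<alpha>))
        = X \<alpha> (k, s)) H"
      using small
    proof eventually_elim
      case (elim \<alpha>)
      then have "(load k (\<eta> \<alpha>) - \<gamma> s) * (- ln \<alpha>) = load k (\<N> \<alpha>) + \<gamma> s * ln \<alpha>"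
        by (simp add: load_scaled field_simps)
      then have "exp ((load k (\<eta> \<alpha>) - \<gamma> s) * (- ln \<alpha>)) = \<alpha> powr \<gamma> s * exp (load k (\<N> \<alpha>))"
        using elim by (simp add: powr_def exp_add mult.commute)
      then show ?case
        using x_star_exponential[of "weights \<alpha>", OF _ p] elim by (simp add: divide_inverse mult.commute)
    qed
    ultimately show "((\<lambda>\<alpha>. X \<alpha> (k, s)) \<longlongrightarrow> 0) H"
      by (auto elim: Lim_transform_eventually)
  qed
  have "x \<in> lp_optima Kbar \<rho> \<gamma>"
    using complementary_slackness_optimal[OF x_feas dual slack] .
  moreover have "h \<in> dual_optima Kbar \<rho> \<gamma>"
    unfolding dual_optima_def load_def[symmetric] mem_Collect_eq
    using x_feas h_nonneg dual slack by (intro bexI[of _ x]) (simp_all add: all_configs_def)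
  ultimately show ?thesis using H G1(1) x_lim h order_trans by blast
qed

end

theorem theorem3:
  fixes Kbar :: "'s::finite \<Rightarrow> ('i::finite \<Rightarrow> nat) set"
    and \<rho> :: "'i \<Rightarrow> real" and \<gamma> :: "'s \<Rightarrow> real" and s1 :: 's
  assumes "\<And>s. finite (Kbar s)"
    and "\<And>s k k'. k \<in> Kbar s \<Longrightarrow> (\<And>i. k' i \<le> k i) \<Longrightarrow> k' \<in> Kbar s"
    and "\<And>s. (\<lambda>_. 0) \<in> Kbar s"
    and "\<And>i. \<exists>s. (\<lambda>j. if j = i then 1 else 0) \<in> Kbar s"
    and "\<And>i. \<rho> i > 0"
    and "(\<Sum>i\<in>UNIV. \<rho> i) = 1"
    and "\<And>s. \<gamma> s > 0"
    and "\<gamma> s1 = 1"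
  shows "((\<lambda>\<alpha>. euclid_dist_set (all_configs Kbar)
            (x_star Kbar \<rho> (\<lambda>s. \<alpha> powr \<gamma> s))
            (lp_optima Kbar \<rho> \<gamma>)) \<longlongrightarrow> 0) (at_right (0::real)) \<and>
         ((\<lambda>\<alpha>. euclid_dist_set UNIV
            (\<lambda>i. inverse (- ln \<alpha>) * nu_star Kbar \<rho> (\<lambda>s. \<alpha> powr \<gamma> s) i)
            (dual_optima Kbar \<rho> \<gamma>)) \<longlongrightarrow> 0) (at_right (0::real))"
proof -
  interpret configurations Kbar \<rho> \<gamma>
    by unfold_locales (use assms in blast)+
  show ?thesis
  proof
    show "((\<lambda>\<alpha>. euclid_dist_set (all_configs Kbar) (x_star Kbar \<rho> (\<lambda>s. \<alpha> powr \<gamma> s))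
        (lp_optima Kbar \<rho> \<gamma>)) \<longlongrightarrow> 0) (at_right (0::real))"
      by (rule euclid_dist_set_tendsto_0) (use cluster_point_optimal in blast)
    have "((\<lambda>\<alpha>. euclid_dist_set UNIV (\<eta> \<alpha>) (dual_optima Kbar \<rho> \<gamma>)) \<longlongrightarrow> 0) (at_right (0::real))"
      by (rule euclid_dist_set_tendsto_0) (use cluster_point_optimal in blast)
    then show "((\<lambda>\<alpha>. euclid_dist_set UNIV
        (\<lambda>i. inverse (- ln \<alpha>) * nu_star Kbar \<rho> (\<lambda>s. \<alpha> powr \<gamma> s) i)
        (dual_optima Kbar \<rho> \<gamma>)) \<longlongrightarrow> 0) (at_right (0::real))"
      by (simp add: \<eta>_def[abs_def])
  qed
qed

end
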